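(* Let $q\ge2$, $d\ge1$, $n\ge1$ be integers, let $\mathbf{x}\in C_H(n,d,r,q)$, and let $\mathbf{y}$ be a word over $A$ obtained from $\mathbf{x}$ by a total of at most $d$ insertions and deletions. Let $a=\left\lfloor\frac{d+len(\mathbf{y})-n}{2}\right\rfloor$ and assume $a\le len(\mathbf{y})$. Define $\tilde{\mathbf{x}}$ by the following procedure: start with $\mathbf{y}'=\mathbf{y}$; then perform the following step $a$ times: let $i>0$ be the lowest integer such that $y'_j\ge y'_{j+1}$ for all $i\le j<len(\mathbf{y}')$, and replace $\mathbf{y}'$ by the word obtained from it by deleting its $i$-th symbol $y'_i$. Let $\tilde{\mathbf{x}}$ be the final value of $\mathbf{y}'$. Then $\tilde{\mathbf{x}}$ has the minimum moment among all words obtained from $\mathbf{y}$ by exactly $a$ deletions; that is, $M(\tilde{\mathbf{x}})\le M(\mathbf{z})$ for every word $\mathbf{z}$ obtained from $\mathbf{y}$ by deleting $a$ symbols.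
   Context: Put $p=q-1$ and $A=\{0,1,\dots,p\}$. The weights $w_i=w_i(q,d)$ are defined by $w_i=0$ for $i\le 0$ and $w_i=1+p\sum_{j=1}^{d}w_{i-j}$ for $i\ge1$. The moment of a word $\mathbf{z}=(z_1,\dots,z_\ell)$ over $A$ of any length $\ell$ is $M(\mathbf{z})=\sum_{i=1}^{\ell} z_iw_i$. For $0\le r<w_{n+1}$, $C_H(n,d,r,q)=\{\mathbf{x}\in A^n : M(\mathbf{x})\equiv r \pmod{w_{n+1}}\}$. $len(\mathbf{s})$ is the number of symbols of $\mathbf{s}$. *)

theory Defs
  imports Complex_Main "HOL-Number_Theory.Cong"
begin

text \<open>Words are lists of naturals; the \<open>i\<close>-th symbol (counted from 1) of \<open>z\<close> is \<open>z ! (i - 1)\<close>.\<close>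

definition alphabet :: "nat \<Rightarrow> nat set" where
  "alphabet q = {0..q - 1}"

text \<open>
  The convention \<open>w\<^sub>i = 0\<close> for \<open>i \<le> 0\<close> is covered by index \<open>0\<close>:
  for \<open>j > i\<close> the truncated difference \<open>i - j\<close> is \<open>0\<close>.
\<close>

fun weight :: "nat \<Rightarrow> nat \<Rightarrow> nat \<Rightarrow> nat" where
  "weight q d i = (if i = 0 then 0 else 1 + (q - 1) * (\<Sum>j = 1..d. weight q d (i - j)))"

text \<open>As a rewrite rule, the defining equation loops.\<close>

declare weight.simps [simp del]

definition moment :: "nat \<Rightarrow> nat \<Rightarrow> nat list \<Rightarrow> nat" where
  "moment q d z = (\<Sum>i = 1..length z. z ! (i - 1) * weight q d i)"

definition C_H :: "nat \<Rightarrow> nat \<Rightarrow> nat \<Rightarrow> nat \<Rightarrow> nat list set" where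
  "C_H n d r q =
     {x. length x = n \<and> set x \<subseteq> alphabet q \<and> [moment q d x = r] (mod weight q d (n + 1))}"

definition delete_nth :: "nat \<Rightarrow> 'a list \<Rightarrow> 'a list" where
  "delete_nth i z = take (i - 1) z @ drop i z"

definition deletion :: "nat list \<Rightarrow> nat list \<Rightarrow> bool" where
  "deletion y z \<longleftrightarrow> (\<exists>i. 1 \<le> i \<and> i \<le> length y \<and> z = delete_nth i y)"

definition insertion :: "nat \<Rightarrow> nat list \<Rightarrow> nat list \<Rightarrow> bool" where
  "insertion q y z \<longleftrightarrow> (\<exists>i c. i \<le> length y \<and> c \<in> alphabet q \<and> z = take i y @ c # drop i y)"

definition indel :: "nat \<Rightarrow> nat list \<Rightarrow> nat list \<Rightarrow> bool" where
  "indel q y z \<longleftrightarrow> insertion q y z \<or> deletion y z"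

definition last_run_start :: "nat list \<Rightarrow> nat" where
  "last_run_start y = (LEAST i. 0 < i \<and> (\<forall>j. i \<le> j \<and> j < length y \<longrightarrow> y ! (j - 1) \<ge> y ! j))"

definition greedy_step :: "nat list \<Rightarrow> nat list" where
  "greedy_step y = delete_nth (last_run_start y) y"

end

theory Submission
  imports Defs "HOL-Library.Sublist"
begin

text \<open>
  The greedy step keeps the prefix \<open>u\<close> and drops the symbol \<open>c\<close> in \<open>y = u @ c # v\<close>, where
  \<open>c # v\<close> is the maximal nonincreasing suffix. It suffices to show that any choice of deletions
  can be modified, without raising the moment, into one that deletes this \<open>c\<close>; the rest is
  induction on the number of deletions. If something in \<open>c # v\<close> is deleted, what remains of
  \<open>c # v\<close> dominates pointwise the suffix of \<open>v\<close> of the same length. Otherwise, restore the last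
  deleted symbol of \<open>u\<close> and delete \<open>c\<close> instead: the position \<open>i\<close> that \<open>c\<close> had in
  the shortened word then receives the last symbol of \<open>u\<close>, which is smaller than \<open>c\<close>, and this gains at least \<open>w\<^sub>i\<close>. The shift of the symbols
  before it costs at most \<open>(q - 1) w\<^bsub>i-1\<^esub>\<close>, which is at most \<open>w\<^sub>i\<close> because \<open>d \<ge> 1\<close>.
\<close>

section \<open>Growth of the weights and changes of the moment\<close>

lemma weight_Suc_ge:
  assumes "d \<ge> 1"
  shows "(q - 1) * weight q d i \<le> weight q d (Suc i)"
proof -
  have "weight q d (Suc i - 1) \<le> (\<Sum>j = 1..d. weight q d (Suc i - j))"
    by (rule member_le_sum) (use assms in auto)
  hence "(q - 1) * weight q d i \<le> (q - 1) * (\<Sum>j = 1..d. weight q d (Suc i - j))"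
    by simp
  also have "\<dots> \<le> weight q d (Suc i)"
    by (subst (2) weight.simps) simp
  finally show ?thesis .
qed

lemma weight_mono_Suc:
  assumes "d \<ge> 1" "q \<ge> 2"
  shows "weight q d i \<le> weight q d (Suc i)"
proof -
  have "1 * weight q d i \<le> (q - 1) * weight q d i"
    by (rule mult_le_mono1) (use assms in simp)
  also have "\<dots> \<le> weight q d (Suc i)"
    by (rule weight_Suc_ge[OF assms(1)])
  finally show ?thesis by simp
qed

lemma moment_Nil [simp]: "moment q d [] = 0"
  by (simp add: moment_def)

lemma moment_snoc: "moment q d (xs @ [x]) = moment q d xs + x * weight q d (Suc (length xs))"
  by (auto simp: moment_def nth_append intro!: sum.cong)

lemma moment_mono:
  assumes "list_all2 (\<le>) xs ys"
  shows "moment q d xs \<le> moment q d ys"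
  unfolding moment_def using assms
  by (auto simp: list_all2_conv_all_nth intro!: sum_mono mult_le_mono1)

lemma moment_append_mono:
  assumes "length xs = length ys" "moment q d xs \<le> moment q d ys"
  shows "moment q d (xs @ v) \<le> moment q d (ys @ v)"
proof (induction v rule: rev_induct)
  case (snoc x v)
  thus ?case
    using assms(1) moment_snoc[of q d "xs @ v" x] moment_snoc[of q d "ys @ v" x] by simp
qed (use assms in simp)

text \<open>Inserting \<open>b\<close> moves each symbol of \<open>s\<close> one place up. Each
  gains at most \<open>q - 1\<close> times the increase of its weight, and with the contribution of
  \<open>b\<close> these increases telescope to the top weight.\<close>

lemma moment_insert_le:
  assumes "d \<ge> 1" "q \<ge> 2" "set (b # s) \<subseteq> alphabet q"
  shows "moment q d (t @ b # s)
    \<le> moment q d (t @ s) + (q - 1) * weight q d (Suc (length t + length s))"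
  using assms(3)
proof (induction s rule: rev_induct)
  case Nil
  thus ?case by (simp add: moment_snoc alphabet_def)
next
  case (snoc l s)
  define W where "W = weight q d (Suc (length t + length s))"
  define W' where "W' = weight q d (Suc (Suc (length t + length s)))"
  \<comment> \<open>With \<open>q - 1\<close> split this way, the \<open>l * W\<close> in the
    inductive bound is the contribution of \<open>l\<close> before its shift;
    \<open>m * W + l * W'\<close> remains.\<close>
  obtain m where m: "q - 1 = l + m"
    using snoc.prems by (auto simp: alphabet_def dest: le_Suc_ex)
  have "m * W \<le> m * W'"
    using weight_mono_Suc[OF assms(1,2)] by (simp add: W_def W'_def)
  moreover have "moment q d (t @ b # s) \<le> moment q d (t @ s) + (l + m) * W"
    using snoc.IH snoc.prems by (simp add: W_def flip: m)
  moreover have "moment q d (t @ b # s @ [l]) = moment q d (t @ b # s) + l * W'"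
    using moment_snoc[of q d "t @ b # s" l] by (simp add: W'_def)
  moreover have "moment q d (t @ s @ [l]) = moment q d (t @ s) + l * W"
    using moment_snoc[of q d "t @ s" l] by (simp add: W_def)
  ultimately have "moment q d (t @ b # s @ [l]) \<le> moment q d (t @ s @ [l]) + (l + m) * W'"
    unfolding add_mult_distrib by linarith
  thus ?case by (simp add: W'_def flip: m)
qed

lemma moment_shift_le:
  assumes "d \<ge> 1" "q \<ge> 2" "set (b # s) \<subseteq> alphabet q" "last (b # s) < c"
  shows "moment q d (t @ b # s) \<le> moment q d (t @ s @ [c])"
proof (cases s rule: rev_cases)
  case Nil
  thus ?thesis using assms by (simp add: moment_snoc)
next
  case (snoc s' l)
  define W where "W = weight q d (Suc (length t + length s'))"
  define W' where "W' = weight q d (Suc (Suc (length t + length s')))"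
  \<comment> \<open>Only \<open>s'\<close> enters the bound. At the position of weight
    \<open>W'\<close> stand \<open>l\<close> on the left and \<open>c\<close>, at least
    \<open>l + 1\<close>, on the right; the spare \<open>W'\<close> absorbs
    \<open>(q - 1) * W\<close>.\<close>
  have "moment q d (t @ b # s') \<le> moment q d (t @ s') + (q - 1) * W"
    unfolding W_def by (rule moment_insert_le) (use assms snoc in auto)
  moreover have "(q - 1) * W \<le> W'"
    unfolding W_def W'_def by (rule weight_Suc_ge[OF assms(1)])
  moreover have "Suc l * W' \<le> c * W'"
    by (rule mult_le_mono1) (use assms snoc in simp)
  moreover have "moment q d (t @ b # s) = moment q d (t @ b # s') + l * W'"
    using moment_snoc[of q d "t @ b # s'" l] by (simp add: W'_def snoc)
  moreover have "moment q d (t @ s @ [c]) = moment q d (t @ s') + l * W + c * W'"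
    using moment_snoc[of q d "t @ s' @ [l]" c] moment_snoc[of q d "t @ s'" l]
    by (simp add: W_def W'_def snoc)
  ultimately show ?thesis by simp
qed

section \<open>Repeated deletion as subsequences\<close>

text \<open>Singles out the last deleted symbol \<open>b\<close>, after which \<open>s\<close> is
  kept whole: the exchange restores this symbol, and a single deletion can be split off with
  it.\<close>

lemma subseq_last_deleted:
  assumes "subseq z y" "length z < length y"
  obtains u b s t where "y = u @ b # s" "z = t @ s" "subseq t u"
  using assms
proof (induction arbitrary: thesis rule: list_emb.induct)
  case (list_emb_Nil ys)
  thus ?case by (cases ys rule: rev_cases) auto
next
  case (list_emb_Cons xs ys y)
  show ?case
  proof (cases "length xs < length ys")
    case True
    then obtain u b s t where "ys = u @ b # s" "xs = t @ s" "subseq t u"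
      using list_emb_Cons.IH by blast
    thus ?thesis using list_emb_Cons.prems(1)[of "y # u" b s t]
      by (simp add: list_emb.list_emb_Cons)
  next
    case False
    \<comment> \<open>Nothing of \<open>ys\<close> is deleted, so the head \<open>y\<close> is the
      last deleted symbol.\<close>
    hence "xs = ys"
      using list_emb_Cons.hyps by (simp add: list_emb_length order_antisym subseq_same_length)
    thus ?thesis using list_emb_Cons.prems(1)[of "[]" y ys "[]"] by simp
  qed
next
  case (list_emb_Cons2 x y xs ys)
  then obtain u b s t where "ys = u @ b # s" "xs = t @ s" "subseq t u"
    by (metis Suc_less_eq length_Cons)
  thus ?case using list_emb_Cons2.prems(1)[of "y # u" b s "y # t"] list_emb_Cons2.hyps by simp
qed

lemma deletion_iff: "deletion y z \<longleftrightarrow> (\<exists>u b s. y = u @ b # s \<and> z = u @ s)"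
proof
  assume "deletion y z"
  then obtain i where i: "1 \<le> i" "i \<le> length y" "z = delete_nth i y"
    by (auto simp: deletion_def)
  have "y = take (i - 1) y @ y ! (i - 1) # drop i y"
    using i id_take_nth_drop[of "i - 1" y] by simp
  with i show "\<exists>u b s. y = u @ b # s \<and> z = u @ s"
    unfolding delete_nth_def by blast
next
  assume "\<exists>u b s. y = u @ b # s \<and> z = u @ s"
  then obtain u b s where "y = u @ b # s" "z = u @ s" by blast
  thus "deletion y z"
    unfolding deletion_def delete_nth_def by (intro exI[of _ "Suc (length u)"]) simp
qed

text \<open>Forgets the order and the indices of the deletions, so that competitors can be cut and
  reassembled as subsequences.\<close>

lemma deletion_relpowp_iff:
  "(deletion ^^ a) y z \<longleftrightarrow> subseq z y \<and> length y = length z + a"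
proof (induction a arbitrary: y)
  case 0
  show ?case by (auto dest: subseq_same_length)
next
  case (Suc a)
  show ?case
  proof
    assume "(deletion ^^ Suc a) y z"
    then obtain y' where "deletion y y'" "(deletion ^^ a) y' z"
      by (blast elim: relpowp_Suc_E2)
    then obtain u b s where "y = u @ b # s" "subseq z (u @ s)" "length (u @ s) = length z + a"
      using Suc.IH by (auto simp: deletion_iff)
    moreover have "subseq (u @ s) (u @ b # s)"
      by (intro list_emb_append_mono) auto
    ultimately show "subseq z y \<and> length y = length z + Suc a"
      using subseq_order.trans by auto
  next
    assume *: "subseq z y \<and> length y = length z + Suc a"
    hence "length z < length y" by simp
    with * obtain u b s t where "y = u @ b # s" "z = t @ s" "subseq t u"
      by (blast elim: subseq_last_deleted)
    hence "deletion y (u @ s)" by (auto simp: deletion_iff)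
    moreover have "(deletion ^^ a) (u @ s) z"
      unfolding Suc.IH using * \<open>y = u @ b # s\<close> \<open>z = t @ s\<close> \<open>subseq t u\<close> by simp
    ultimately show "(deletion ^^ Suc a) y z" by (rule relpowp_Suc_I2)
  qed
qed

section \<open>Nonincreasing suffixes and the greedy step\<close>

text \<open>The k-th last symbol of \<open>t\<close> comes from a position of \<open>w\<close> at or
  before that of the k-th last symbol of \<open>w\<close>, hence is at least as large.\<close>

lemma suffix_le_subseq:
  fixes w t :: "nat list"
  assumes "sorted_wrt (\<ge>) w" "subseq t w"
  shows "list_all2 (\<le>) (drop (length w - length t) w) t"
  using assms(2,1)
proof (induction rule: list_emb.induct)
  case (list_emb_Cons xs ys y)
  thus ?case by (simp add: Suc_diff_le list_emb_length)
next
  case (list_emb_Cons2 x y xs ys)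
  define m where "m = length ys - length xs"
  have IH: "list_all2 (\<le>) (drop m ys) xs"
    using list_emb_Cons2 by (simp add: m_def)
  show ?case
  proof (cases m)
    case 0
    thus ?thesis using IH list_emb_Cons2.hyps m_def by simp
  next
    case (Suc m')
    hence "m' < length ys" by (simp add: m_def)
    \<comment> \<open>\<open>drop m (y # ys)\<close> is \<open>drop m' ys\<close>, so its head
      \<open>ys ! m'\<close> is compared with the kept symbol \<open>x = y\<close>.\<close>
    hence "drop m' ys = ys ! m' # drop m ys" "ys ! m' \<le> y"
      using list_emb_Cons2.prems Suc by (simp_all add: Cons_nth_drop_Suc)
    thus ?thesis using IH list_emb_Cons2.hyps Suc m_def by simp
  qed
qed simp

text \<open>Trades the index of the greedy step for a splitting of the word. Minimality of the index
  yields \<open>last u < c\<close>, the ascent that pays for the exchange.\<close>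

lemma greedy_step_decomp:
  assumes "y \<noteq> []"
  obtains u c v where "y = u @ c # v" "greedy_step y = u @ v"
    "sorted_wrt (\<ge>) (c # v)" "u \<noteq> [] \<Longrightarrow> last u < c"
proof -
  define P where
    "P = (\<lambda>i. 0 < i \<and> (\<forall>j. i \<le> j \<and> j < length y \<longrightarrow> y ! (j - 1) \<ge> y ! j))"
  define i where "i = last_run_start y"
  have i_Least: "i = (LEAST i. P i)"
    by (simp add: i_def last_run_start_def P_def)
  \<comment> \<open>The condition on \<open>j\<close> is vacuous here, so a least index exists and
    lies inside the word.\<close>
  have len: "P (length y)" using assms by (simp add: P_def)
  have "P i" unfolding i_Least using len by (rule LeastI)
  have "i \<le> length y" unfolding i_Least using len by (rule Least_le)
  have "0 < i" using \<open>P i\<close> by (simp add: P_def)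
  then obtain k where k: "i = Suc k" using gr0_implies_Suc by blast
  define u c v where "u = take k y" and "c = y ! k" and "v = drop (Suc k) y"
  have cv: "c # v = drop k y"
    using \<open>i \<le> length y\<close> k by (simp add: c_def v_def Cons_nth_drop_Suc)
  have "y = u @ c # v" by (simp add: cv u_def)
  moreover have "greedy_step y = u @ v"
    by (simp add: greedy_step_def delete_nth_def k u_def v_def flip: i_def)
  moreover have "sorted_wrt (\<ge>) (c # v)"
  proof -
    have "y ! (k + Suc j) \<le> y ! (k + j)" if "Suc (k + j) < length y" for j
      using \<open>P i\<close> that k by (auto simp: P_def dest: spec[of _ "Suc (k + j)"])
    thus ?thesis
      unfolding cv by (subst sorted_wrt_iff_nth_Suc_transp) (auto simp: transp_def)
  qed
  moreover have "last u < c" if "u \<noteq> []"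
  proof (rule ccontr)
    \<comment> \<open>Otherwise the nonincreasing suffix extends one symbol to the left, and
      \<open>k\<close> satisfies \<open>P\<close> too.\<close>
    assume "\<not> last u < c"
    from that have "0 < k" by (auto simp: u_def)
    have "last u = y ! (k - 1)"
      using that \<open>0 < k\<close> \<open>i \<le> length y\<close> k by (simp add: u_def last_conv_nth min_def)
    have "y ! (j - 1) \<ge> y ! j" if "k \<le> j" "j < length y" for j
    proof (cases "j = k")
      case True
      thus ?thesis using \<open>\<not> last u < c\<close> \<open>last u = y ! (k - 1)\<close> by (simp add: c_def)
    next
      case False
      thus ?thesis using \<open>P i\<close> that k by (simp add: P_def)
    qed
    hence "P k" using \<open>0 < k\<close> by (simp add: P_def)
    hence "i \<le> k" unfolding i_Least by (rule Least_le)
    thus False using k by simp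
  qed
  ultimately show thesis by (rule that)
qed

section \<open>Exchange and optimality\<close>

lemma greedy_exchange:
  assumes "d \<ge> 1" "q \<ge> 2" "set y \<subseteq> alphabet q" "subseq z y" "length z < length y"
  obtains z' where "subseq z' (greedy_step y)" "length z' = length z"
    "moment q d z' \<le> moment q d z"
proof -
  from assms(5) have "y \<noteq> []" by auto
  then obtain u c v where y: "y = u @ c # v" and g: "greedy_step y = u @ v"
    and srt: "sorted_wrt (\<ge>) (c # v)" and lst: "u \<noteq> [] \<Longrightarrow> last u < c"
    by (rule greedy_step_decomp) blast
  from assms(4) obtain z1 z2 where z: "z = z1 @ z2" "subseq z1 u" "subseq z2 (c # v)"
    unfolding y by (auto simp: subseq_append_iff)
  show thesis
  proof (cases "length z2 \<le> length v")
    case True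
    \<comment> \<open>As \<open>z2\<close> is no longer than \<open>v\<close>, the suffix of
      \<open>c # v\<close> of its length does not reach \<open>c\<close>.\<close>
    let ?z2' = "drop (length v - length z2) v"
    have "list_all2 (\<le>) ?z2' z2"
      using suffix_le_subseq[OF srt z(3)] True by (simp add: Suc_diff_le)
    hence "list_all2 (\<le>) (z1 @ ?z2') (z1 @ z2)"
      by (intro list_all2_appendI) (simp_all add: list.rel_refl)
    hence "moment q d (z1 @ ?z2') \<le> moment q d z"
      unfolding z by (rule moment_mono)
    moreover have "subseq ?z2' v" by (rule suffix_imp_subseq[OF suffix_drop])
    hence "subseq (z1 @ ?z2') (greedy_step y)"
      unfolding g using z(2) by (rule list_emb_append_mono[rotated])
    ultimately show thesis using True by (intro that) (auto simp: z)
  next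
    case False
    hence "length z2 = length (c # v)" using list_emb_length[OF z(3)] by simp
    hence z2: "z2 = c # v" using z(3) subseq_same_length by blast
    hence "length z1 < length u" using assms(5) by (simp add: y z)
    with z(2) obtain u1 b s t where u: "u = u1 @ b # s" "z1 = t @ s" "subseq t u1"
      by (rule subseq_last_deleted)
    have "moment q d (t @ b # s) \<le> moment q d (t @ s @ [c])"
      by (rule moment_shift_le) (use assms lst y u in auto)
    \<comment> \<open>Restoring \<open>b\<close> offsets the removal of \<open>c\<close>, so
      \<open>v\<close> keeps its positions.\<close>
    hence "moment q d ((t @ b # s) @ v) \<le> moment q d ((t @ s @ [c]) @ v)"
      by (rule moment_append_mono[rotated]) simp
    moreover have "subseq ((t @ b # s) @ v) (greedy_step y)"
      unfolding g u(1) by (intro list_emb_append_mono) (use u(3) in auto)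
    ultimately show thesis by (intro that) (auto simp: z z2 u)
  qed
qed

text \<open>Induction on \<open>a\<close> with \<open>y\<close> arbitrary: the exchange leads from
  each competitor to one reachable after the greedy step. The first conjunct puts the greedy word
  among the competitors, so the minimum is attained.\<close>

lemma greedy_optimal:
  assumes "d \<ge> 1" "q \<ge> 2" "set y \<subseteq> alphabet q" "a \<le> length y"
  shows "(deletion ^^ a) y ((greedy_step ^^ a) y)
    \<and> (\<forall>z. (deletion ^^ a) y z \<longrightarrow> moment q d ((greedy_step ^^ a) y) \<le> moment q d z)"
  using assms(3,4)
proof (induction a arbitrary: y)
  case 0
  thus ?case by simp
next
  case (Suc a)
  hence "y \<noteq> []" by auto
  then obtain u c v where y: "y = u @ c # v" and g: "greedy_step y = u @ v"
    by (rule greedy_step_decomp) blast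
  define y' where "y' = greedy_step y"
  have y': "set y' \<subseteq> alphabet q" "length y = Suc (length y')"
    using Suc.prems unfolding y'_def g by (auto simp: y)
  have eq: "(greedy_step ^^ Suc a) y = (greedy_step ^^ a) y'"
    by (simp add: funpow_swap1 y'_def)
  have del: "(deletion ^^ a) y' ((greedy_step ^^ a) y')"
    and opt: "\<And>z. (deletion ^^ a) y' z \<Longrightarrow> moment q d ((greedy_step ^^ a) y') \<le> moment q d z"
    using Suc.IH[of y'] y' Suc.prems by auto
  have "deletion y y'" unfolding y'_def g deletion_iff using y by blast
  hence "(deletion ^^ Suc a) y ((greedy_step ^^ a) y')"
    using del by (rule relpowp_Suc_I2)
  moreover have "moment q d ((greedy_step ^^ a) y') \<le> moment q d z"
    if "(deletion ^^ Suc a) y z" for z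
  proof -
    from that have z: "subseq z y" "length y = length z + Suc a"
      by (simp_all only: deletion_relpowp_iff)
    then obtain z' where z': "subseq z' y'" "length z' = length z"
      "moment q d z' \<le> moment q d z"
      using greedy_exchange[OF assms(1,2) Suc.prems(1), of z] by (auto simp: y'_def)
    hence "(deletion ^^ a) y' z'" using z y' by (simp add: deletion_relpowp_iff)
    from opt[OF this] z'(3) show ?thesis by simp
  qed
  ultimately show ?case unfolding eq by blast
qed

text \<open>The shift estimate needs the symbols of the received word to be at most
  \<open>q - 1\<close>; this bound is inherited from the code word.\<close>

lemma indel_alphabet:
  assumes "indel q x y" "set x \<subseteq> alphabet q"
  shows "set y \<subseteq> alphabet q"
  using assms set_take_subset set_drop_subset
  by (fastforce simp: indel_def insertion_def deletion_iff)

lemma indel_relpowp_alphabet: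
  assumes "(indel q ^^ k) x y" "set x \<subseteq> alphabet q"
  shows "set y \<subseteq> alphabet q"
  using assms
proof (induction k arbitrary: y)
  case (Suc k)
  thus ?case by (blast elim: relpowp_Suc_E dest: indel_alphabet)
qed simp

theorem theorem3:
  fixes q d n r a k :: nat and x y :: "nat list"
  assumes "q \<ge> 2" and "d \<ge> 1" and "n \<ge> 1"
    and "r < weight q d (n + 1)"
    and "x \<in> C_H n d r q"
    and "k \<le> d" and "(indel q ^^ k) x y"
    and "int a = \<lfloor>(real d + real (length y) - real n) / 2\<rfloor>"
    and "a \<le> length y"
  shows "(deletion ^^ a) y ((greedy_step ^^ a) y)
    \<and> (\<forall>z. (deletion ^^ a) y z \<longrightarrow> moment q d ((greedy_step ^^ a) y) \<le> moment q d z)"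
proof -
  have "set y \<subseteq> alphabet q"
    using assms(5,7) by (auto simp: C_H_def dest: indel_relpowp_alphabet)
  with assms(1,2,9) show ?thesis by (intro greedy_optimal)
qed

end
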